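(* The exponential generating function $F_1(x,y)$ of connected bipartite graphs with Betti number $1$ is expressed as $F_1 = f_1(W)$ with $f_1(w) = -\frac{1}{2}\big( \log(1-w) + w \big)$, i.e., \[ F_1(x,y) = -\frac{1}{2}\Big( \log(1-T_xT_y) + T_x T_y \Big). \]
   Context: For integers $r,s\ge 0$ and $k$, $N_{\rm bi}(r,s,k)$ is the number of connected bipartite simple graphs with labeled bipartition $V_1\sqcup V_2$, $|V_1|=r$, $|V_2|=s$, having exactly $r+s+k-1$ edges; equivalently, the number of connected spanning subgraphs of the complete bipartite graph $K_{r,s}$ with $r+s+k-1$ edges (so the Betti number is $k$). Conventions: if $rs=0$, then $N_{\rm bi}(r,s,k)=1$ if $k=0$ and $(r,s)\in\{(1,0),(0,1)\}$, and $0$ otherwise. It is known that $N_{\rm bi}(r,s,0)=r^{s-1}s^{r-1}$ for $r,s\ge1$. For $k\ge 0$ let $F_k(x,y) = \sum_{r,s=0}^{\infty} \frac{N_{\rm bi}(r,s,k)}{r!s!}x^r y^s$ (formal power series), and put $T:=F_0$. With the Euler operators $D_x=x\partial_x$, $D_y=y\partial_y$, put $T_x = D_xT$, $T_y=D_yT$, $W=T_xT_y$. (Subscripts $x,y$ denote application of $D_x,D_y$, not ordinary partial derivatives.) *)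

theory Defs
  imports "HOL-Computational_Algebra.Formal_Power_Series"
begin

unbundle fps_syntax

text \<open>The two sides of \<open>K\<^bsub>r,s\<^esub>\<close> are \<open>Inl ` {..<r}\<close> and \<open>Inr ` {..<s}\<close>; edges are
  unordered pairs of vertices.\<close>

definition bi_verts :: "nat \<Rightarrow> nat \<Rightarrow> (nat + nat) set" where
  "bi_verts r s = Inl ` {..<r} \<union> Inr ` {..<s}"

definition complete_bi_edges :: "nat \<Rightarrow> nat \<Rightarrow> (nat + nat) set set" where
  "complete_bi_edges r s = {{Inl i, Inr j} | i j. i < r \<and> j < s}"

definition graph_connected :: "'v set \<Rightarrow> 'v set set \<Rightarrow> bool" where
  "graph_connected V E \<longleftrightarrow> V \<noteq> {} \<and> (\<forall>u\<in>V. \<forall>v\<in>V. (u, v) \<in> {(a, b). {a, b} \<in> E}\<^sup>*)"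

definition N_bi :: "nat \<Rightarrow> nat \<Rightarrow> nat \<Rightarrow> nat" where
  "N_bi r s k =
     (if r = 0 \<or> s = 0 then (if k = 0 \<and> (r, s) \<in> {(1, 0), (0, 1)} then 1 else 0)
      else card {E. E \<subseteq> complete_bi_edges r s \<and> graph_connected (bi_verts r s) E
                    \<and> card E = r + s + k - 1})"

text \<open>A power series in \<open>x\<close> and \<open>y\<close> is an element of \<^typ>\<open>rat fps fps\<close>, where \<open>x\<close> is the
  outer and \<open>y\<close> the inner variable: the coefficient of \<open>x\<^sup>r y\<^sup>s\<close> in \<open>G\<close> is \<open>G $ r $ s\<close>.\<close>

definition F_bi :: "nat \<Rightarrow> rat fps fps" where
  "F_bi k = Abs_fps (\<lambda>r. Abs_fps (\<lambda>s. of_nat (N_bi r s k) / (fact r * fact s)))"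

definition D_x :: "rat fps fps \<Rightarrow> rat fps fps" where
  "D_x G = fps_XD G"

definition D_y :: "rat fps fps \<Rightarrow> rat fps fps" where
  "D_y G = Abs_fps (\<lambda>r. fps_XD (G $ r))"

definition T_x :: "rat fps fps" where
  "T_x = D_x (F_bi 0)"

definition T_y :: "rat fps fps" where
  "T_y = D_y (F_bi 0)"

definition W :: "rat fps fps" where
  "W = T_x * T_y"

text \<open>Substitution of a bivariate series \<open>G\<close> into a univariate one. The library composition
  truncates the sum at the degree in the outer variable \<open>x\<close>, so this is the genuine
  substitution only if \<open>G\<close> is divisible by \<open>x\<close>; that holds for \<^const>\<open>W\<close>.\<close>

definition subst2 :: "rat fps \<Rightarrow> rat fps fps \<Rightarrow> rat fps fps" where
  "subst2 f G = Abs_fps (\<lambda>n. fps_const (f $ n)) oo G"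

lemma W_nth_0: "W $ 0 = 0"
  by (simp add: W_def T_x_def D_x_def)

text \<open>\<^term>\<open>fps_ln 1\<close> is the series of \<open>log (1 + w)\<close>.\<close>

definition f_1 :: "rat fps" where
  "f_1 = fps_const (- 1 / 2) * ((fps_ln 1 oo (- fps_X)) + fps_X)"

end

theory Submission
  imports Defs
begin

text \<open>
  Marking an edge of a connected bipartite graph and deleting it either leaves a connected graph with
  one edge less or splits the graph into two connected graphs, each with a marked end point of the
  deleted edge. For Betti numbers 0 and 1 this gives \<open>T\<^sub>x + T\<^sub>y - T = T\<^sub>x T\<^sub>y\<close> and
  \<open>L F\<^sub>1 = T\<^sub>x\<^sub>y - W\<close> for the derivation \<open>L = (1 - T\<^sub>y) D\<^sub>x + (1 - T\<^sub>x) D\<^sub>y\<close>. Differentiating the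
  first equation yields \<open>L T\<^sub>x = T\<^sub>x\<close> and \<open>L T\<^sub>y = T\<^sub>y\<close>, hence \<open>L W = 2 W\<close>. To lowest order, \<open>L\<close>
  multiplies a homogeneous polynomial by its degree, so equations \<open>L Z = C Z\<close> have at most one solution
  with prescribed resonant coefficients. This rigidity forces \<open>T\<^sub>x\<^sub>y = T\<^sub>y T\<^sub>x\<^sub>x\<close>, so that
  \<open>T\<^sub>x\<^sub>y = W / (1 - W)\<close>, and then \<open>F\<^sub>1 = f\<^sub>1(W)\<close>, since \<open>L (f\<^sub>1(W)) = 2 W f\<^sub>1'(W) = W\<^sup>2 / (1 - W)\<close>.
\<close>

section \<open>Connected bipartite graphs\<close>

text \<open>An edge is stored as an ordered pair, left end point first, so edge sets live in a
  product and every edge has a canonical orientation. Walks use this symmetric relation on the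
  disjoint union of the sides.\<close>

definition adj :: "('a \<times> 'b) set \<Rightarrow> ('a + 'b) rel" where
  "adj R = {(Inl a, Inr b) | a b. (a, b) \<in> R} \<union> {(Inr b, Inl a) | a b. (a, b) \<in> R}"

text \<open>One side may be empty: a single vertex without edges counts as connected, because
  deleting a pendant edge leaves such a piece.\<close>

definition bi_connected :: "'a set \<Rightarrow> 'b set \<Rightarrow> ('a \<times> 'b) set \<Rightarrow> bool" where
  "bi_connected A B R \<longleftrightarrow> R \<subseteq> A \<times> B \<and> A <+> B \<noteq> {} \<and>
     (\<forall>u\<in>A <+> B. \<forall>v\<in>A <+> B. (u, v) \<in> (adj R)\<^sup>*)"

definition bi_graphs :: "'a set \<Rightarrow> 'b set \<Rightarrow> nat \<Rightarrow> ('a \<times> 'b) set set" where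
  "bi_graphs A B m = {R. bi_connected A B R \<and> card R = m}"

lemma adj_iff [simp]:
  "(Inl a, Inr b) \<in> adj R \<longleftrightarrow> (a, b) \<in> R"
  "(Inr b, Inl a) \<in> adj R \<longleftrightarrow> (a, b) \<in> R"
  "(Inl a, Inl a') \<notin> adj R"
  "(Inr b, Inr b') \<notin> adj R"
  by (auto simp: adj_def)

lemma adj_cases:
  assumes "(u, v) \<in> adj R"
  obtains a b where "(a, b) \<in> R" "u = Inl a" "v = Inr b"
    | a b where "(a, b) \<in> R" "u = Inr b" "v = Inl a"
  using assms by (auto simp: adj_def)

lemma adj_mono: "R \<subseteq> S \<Longrightarrow> adj R \<subseteq> adj S"
  by (auto simp: adj_def)

lemma sym_adj: "sym (adj R)"
  by (auto simp: adj_def sym_def)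

lemma adj_rtrancl_sym: "(u, v) \<in> (adj R)\<^sup>* \<Longrightarrow> (v, u) \<in> (adj R)\<^sup>*"
  using sym_rtrancl[OF sym_adj] by (rule symD)

lemma bi_connectedI:
  assumes "R \<subseteq> A \<times> B" "u \<in> A <+> B" "\<And>v. v \<in> A <+> B \<Longrightarrow> (u, v) \<in> (adj R)\<^sup>*"
  shows "bi_connected A B R"
  unfolding bi_connected_def
  by (metis adj_rtrancl_sym assms empty_iff rtrancl_trans)

lemma bi_connected_mono:
  assumes "bi_connected A B R" "R \<subseteq> S" "S \<subseteq> A \<times> B"
  shows "bi_connected A B S"
  using assms rtrancl_mono[OF adj_mono[OF assms(2)]] unfolding bi_connected_def by blast

lemma bi_connected_image:
  assumes "bi_connected A B R"
  shows "bi_connected (f ` A) (g ` B) (map_prod f g ` R)"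
proof -
  have step: "(map_sum f g u, map_sum f g v) \<in> (adj (map_prod f g ` R))\<^sup>*"
    if "(u, v) \<in> (adj R)\<^sup>*" for u v
    using that
  proof (induction rule: rtrancl_induct)
    case (step y z)
    from step.hyps(2) have "(map_sum f g y, map_sum f g z) \<in> adj (map_prod f g ` R)"
      by (cases rule: adj_cases) force+
    with step.IH show ?case by (rule rtrancl_into_rtrancl)
  qed simp
  have verts: "f ` A <+> g ` B = map_sum f g ` (A <+> B)"
    by (auto simp: Plus_def image_image image_Un)
  show ?thesis
    unfolding bi_connected_def
  proof (intro conjI ballI)
    show "map_prod f g ` R \<subseteq> f ` A \<times> g ` B" "f ` A <+> g ` B \<noteq> {}"
      using assms unfolding bi_connected_def verts by auto
    fix u v assume "u \<in> f ` A <+> g ` B" "v \<in> f ` A <+> g ` B"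
    then obtain u' v' where "u' \<in> A <+> B" "v' \<in> A <+> B"
      and uv: "u = map_sum f g u'" "v = map_sum f g v'"
      unfolding verts by blast
    then have "(u', v') \<in> (adj R)\<^sup>*"
      using assms unfolding bi_connected_def by blast
    then show "(u, v) \<in> (adj (map_prod f g ` R))\<^sup>*"
      unfolding uv by (rule step)
  qed
qed

section \<open>Relabelling of vertices\<close>

lemma finite_bi_graphs:
  assumes "finite A" "finite B"
  shows "finite (bi_graphs A B m)"
  by (rule finite_subset[of _ "Pow (A \<times> B)"])
    (use assms in \<open>auto simp: bi_graphs_def bi_connected_def\<close>)

text \<open>\<open>map_prod f g\<close> acts injectively on edge sets and keeps connectedness and
  the number of edges. The inverse bijections then give equality.\<close>

lemma card_bi_graphs_le:
  assumes "finite A'" "finite B'" "bij_betw f A A'" "bij_betw g B B'"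
  shows "card (bi_graphs A B m) \<le> card (bi_graphs A' B' m)"
proof (rule card_inj_on_le[where f = "image (map_prod f g)"])
  have inj: "inj_on (map_prod f g) (A \<times> B)"
    using assms by (simp add: bij_betw_def map_prod_inj_on)
  have sub: "bi_graphs A B m \<subseteq> Pow (A \<times> B)"
    by (auto simp: bi_graphs_def bi_connected_def)
  show "inj_on (image (map_prod f g)) (bi_graphs A B m)"
    using inj_on_image_Pow[OF inj] sub by (rule inj_on_subset)
  show "image (map_prod f g) ` bi_graphs A B m \<subseteq> bi_graphs A' B' m"
  proof safe
    fix R assume R: "R \<in> bi_graphs A B m"
    then have "inj_on (map_prod f g) R" "card R = m"
      using sub inj by (auto simp: bi_graphs_def intro: inj_on_subset)
    then have "card (map_prod f g ` R) = m"
      by (simp add: card_image)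
    then show "map_prod f g ` R \<in> bi_graphs A' B' m"
      using R bi_connected_image[of A B R f g] assms(3,4)
      by (simp add: bi_graphs_def bij_betw_def)
  qed
  show "finite (bi_graphs A' B' m)"
    using assms by (intro finite_bi_graphs)
qed

lemma card_bi_graphs_cong:
  assumes "finite A" "finite B" "finite A'" "finite B'" "card A = card A'" "card B = card B'"
  shows "card (bi_graphs A B m) = card (bi_graphs A' B' m)"
proof -
  obtain f g where "bij_betw f A A'" "bij_betw g B B'"
    using assms finite_same_card_bij by metis
  then show ?thesis
    using assms by (intro antisym card_bi_graphs_le) (auto intro: bij_betw_inv_into)
qed

definition conn_count :: "nat \<Rightarrow> nat \<Rightarrow> nat \<Rightarrow> nat" where
  "conn_count r s m = card (bi_graphs {..<r} {..<s} m)"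

lemma card_bi_graphs:
  assumes "finite A" "finite B"
  shows "card (bi_graphs A B m) = conn_count (card A) (card B) m"
  unfolding conn_count_def using assms by (intro card_bi_graphs_cong) auto

section \<open>Joining and splitting along a bridge\<close>

text \<open>A bridge \<open>(a, b)\<close> splits a connected graph into the component of \<open>a\<close>, with vertex set
  \<open>A1 <+> B1\<close>, and the component of \<open>b\<close>.\<close>

lemma reachable_component:
  assumes R1: "bi_connected A1 B1 R1" and a: "a \<in> A1"
    and R2: "R2 \<subseteq> (- A1) \<times> (- B1)"
  shows "(Inl a, v) \<in> (adj (R1 \<union> R2))\<^sup>* \<longleftrightarrow> v \<in> A1 <+> B1"
proof
  assume "(Inl a, v) \<in> (adj (R1 \<union> R2))\<^sup>*"
  then show "v \<in> A1 <+> B1"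
  proof (induction rule: rtrancl_induct)
    case (step y z)
    from step.hyps(2) step.IH show ?case
      using R1 R2 unfolding bi_connected_def by (cases rule: adj_cases) auto
  qed (use a in auto)
next
  assume "v \<in> A1 <+> B1"
  with R1 a have "(Inl a, v) \<in> (adj R1)\<^sup>*"
    unfolding bi_connected_def by blast
  then show "(Inl a, v) \<in> (adj (R1 \<union> R2))\<^sup>*"
    using rtrancl_mono[OF adj_mono[of R1 "R1 \<union> R2"]] by blast
qed

lemma bi_connected_join:
  assumes R1: "bi_connected A1 B1 R1" and R2: "bi_connected (A - A1) (B - B1) R2"
    and sub: "A1 \<subseteq> A" "B1 \<subseteq> B" and a: "a \<in> A1" and b: "b \<in> B - B1"
  shows "bi_connected A B (insert (a, b) (R1 \<union> R2))"
proof (rule bi_connectedI[of _ _ _ "Inl a"])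
  let ?R = "insert (a, b) (R1 \<union> R2)"
  show "?R \<subseteq> A \<times> B" "Inl a \<in> A <+> B"
    using assms unfolding bi_connected_def by auto
  fix v assume v: "v \<in> A <+> B"
  show "(Inl a, v) \<in> (adj ?R)\<^sup>*"
  proof (cases "v \<in> A1 <+> B1")
    case True
    with R1 a have "(Inl a, v) \<in> (adj R1)\<^sup>*" unfolding bi_connected_def by blast
    then show ?thesis using rtrancl_mono[OF adj_mono[of R1 ?R]] by blast
  next
    case False
    with v have "v \<in> (A - A1) <+> (B - B1)" by auto
    with R2 b have "(Inr b, v) \<in> (adj R2)\<^sup>*" unfolding bi_connected_def by blast
    then have "(Inr b, v) \<in> (adj ?R)\<^sup>*" using rtrancl_mono[OF adj_mono[of R2 ?R]] by blast
    moreover have "(Inl a, Inr b) \<in> adj ?R" by simp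
    ultimately show ?thesis by (rule converse_rtrancl_into_rtrancl[rotated])
  qed
qed

text \<open>\<open>A1 <+> B1\<close> is the component of \<open>a\<close> in \<open>R\<close>. A
  walk that uses the edge \<open>(a, b)\<close> lands on \<open>a\<close> or \<open>b\<close>, so
  every vertex is reachable in \<open>R\<close> from one of the two. Were \<open>b\<close> in the
  component of \<open>a\<close>, \<open>R\<close> would be connected; hence the remaining vertices
  form the component of \<open>b\<close>.\<close>

lemma bi_connected_split:
  assumes conn: "bi_connected A B (insert (a, b) R)" and nconn: "\<not> bi_connected A B R"
  defines "A1 \<equiv> {x. (Inl a, Inl x) \<in> (adj R)\<^sup>*}" and "B1 \<equiv> {y. (Inl a, Inr y) \<in> (adj R)\<^sup>*}"
  shows "A1 \<subseteq> A" "B1 \<subseteq> B" "a \<in> A1" "b \<in> B - B1"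
    "R = (R \<inter> A1 \<times> B1) \<union> (R \<inter> (A - A1) \<times> (B - B1))"
    "bi_connected A1 B1 (R \<inter> A1 \<times> B1)"
    "bi_connected (A - A1) (B - B1) (R \<inter> (A - A1) \<times> (B - B1))"
proof -
  from conn have R: "R \<subseteq> A \<times> B" and ab: "a \<in> A" "b \<in> B"
    unfolding bi_connected_def by auto
  have comp: "v \<in> A1 <+> B1 \<longleftrightarrow> (Inl a, v) \<in> (adj R)\<^sup>*" for v
    by (cases v) (auto simp: A1_def B1_def)
  have verts: "v \<in> A <+> B" if "(Inl a, v) \<in> (adj R)\<^sup>*" for v
    using that
  proof (induction rule: rtrancl_induct)
    case (step y z)
    from step.hyps(2) R show ?case by (cases rule: adj_cases) auto
  qed (use ab in auto)
  show A1: "A1 \<subseteq> A" and B1: "B1 \<subseteq> B" using verts by (auto simp: A1_def B1_def)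
  show a: "a \<in> A1" by (simp add: A1_def)
  have closed: "x \<in> A1 \<longleftrightarrow> y \<in> B1" if "(x, y) \<in> R" for x y
    using that unfolding A1_def B1_def by (auto intro: rtrancl_into_rtrancl)
  show decomp: "R = (R \<inter> A1 \<times> B1) \<union> (R \<inter> (A - A1) \<times> (B - B1))"
    using closed R by auto
  have reach: "(Inl a, v) \<in> (adj R)\<^sup>* \<or> (Inr b, v) \<in> (adj R)\<^sup>*" if "v \<in> A <+> B" for v
  proof -
    have "(Inl a, v) \<in> (adj (insert (a, b) R))\<^sup>*"
      using conn that ab unfolding bi_connected_def by blast
    then show ?thesis
    proof (induction rule: rtrancl_induct)
      case (step y z)
      show ?case
      proof (cases "(y, z) \<in> adj R")
        case True
        with step.IH show ?thesis by (auto intro: rtrancl_into_rtrancl)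
      next
        case False
        with step.hyps(2) have "z = Inl a \<or> z = Inr b" by (auto elim: adj_cases)
        then show ?thesis by auto
      qed
    qed simp
  qed
  show b: "b \<in> B - B1"
  proof -
    have "b \<notin> B1"
    proof
      assume "b \<in> B1"
      then have "(Inl a, v) \<in> (adj R)\<^sup>*" if "v \<in> A <+> B" for v
        using reach[OF that] unfolding B1_def by (auto intro: rtrancl_trans)
      then have "bi_connected A B R"
        using R ab by (intro bi_connectedI[of _ _ _ "Inl a"]) auto
      with nconn show False ..
    qed
    with ab show ?thesis by simp
  qed
  show "bi_connected A1 B1 (R \<inter> A1 \<times> B1)"
  proof (rule bi_connectedI[of _ _ _ "Inl a"])
    fix v assume "v \<in> A1 <+> B1"
    then have "(Inl a, v) \<in> (adj R)\<^sup>*" by (simp add: comp)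
    then show "(Inl a, v) \<in> (adj (R \<inter> A1 \<times> B1))\<^sup>*"
    proof (induction rule: rtrancl_induct)
      case (step y z)
      have "y \<in> A1 <+> B1" using step.hyps(1) by (simp add: comp)
      with step.hyps(2) have "(y, z) \<in> adj (R \<inter> A1 \<times> B1)"
        using closed by (cases rule: adj_cases) auto
      with step.IH show ?case by (rule rtrancl_into_rtrancl)
    qed simp
  qed (use a in auto)
  show "bi_connected (A - A1) (B - B1) (R \<inter> (A - A1) \<times> (B - B1))"
  proof (rule bi_connectedI[of _ _ _ "Inr b"])
    fix v assume v: "v \<in> (A - A1) <+> (B - B1)"
    then have "(Inl a, v) \<notin> (adj R)\<^sup>*" by (auto simp: A1_def B1_def)
    moreover have "v \<in> A <+> B" using v by auto
    ultimately have "(Inr b, v) \<in> (adj R)\<^sup>*" using reach by blast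
    \<comment> \<open>The induction carries membership in the complement along, since this places
      the next edge in the restricted relation.\<close>
    then have "(Inr b, v) \<in> (adj (R \<inter> (A - A1) \<times> (B - B1)))\<^sup>* \<and> v \<in> (A - A1) <+> (B - B1)"
    proof (induction rule: rtrancl_induct)
      case (step y z)
      from step.hyps(2) step.IH closed R
      have "(y, z) \<in> adj (R \<inter> (A - A1) \<times> (B - B1)) \<and> z \<in> (A - A1) <+> (B - B1)"
        by (cases rule: adj_cases) auto
      with step.IH show ?case by (auto intro: rtrancl_into_rtrancl)
    qed (use b in auto)
    then show "(Inr b, v) \<in> (adj (R \<inter> (A - A1) \<times> (B - B1)))\<^sup>*" ..
  qed (use b in auto)
qed

text \<open>Count pairs of an edge \<open>e\<close> and a set \<open>R\<close> without
  \<open>e\<close> such that \<open>insert e R\<close> is connected with \<open>Suc n\<close> edges.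
  If \<open>R\<close> is connected, \<open>e\<close> is one of \<open>card A * card B - n\<close>
  non-edges; the negative part is moved to the left side. Otherwise \<open>R\<close> consists of the
  components of the two ends of \<open>e\<close>, with \<open>i\<close> and \<open>n - i\<close>
  edges. The orientation of \<open>e\<close> tells them apart, so no factor 1/2 arises.\<close>

lemma bi_graphs_recursion:
  assumes fin: "finite A" "finite B"
  shows "Suc n * card (bi_graphs A B (Suc n)) + n * card (bi_graphs A B n) =
    card A * card B * card (bi_graphs A B n) +
    (\<Sum>A1\<in>Pow A. \<Sum>B1\<in>Pow B. card A1 * card (B - B1) *
      (\<Sum>i\<le>n. card (bi_graphs A1 B1 i) * card (bi_graphs (A - A1) (B - B1) (n - i))))"
proof -
  define P where "P = {(e, R). e \<notin> R \<and> insert e R \<in> bi_graphs A B (Suc n)}"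
  define Q where "Q = (SIGMA E : bi_graphs A B (Suc n). E)"
  define P1 where "P1 = (SIGMA R : bi_graphs A B n. A \<times> B - R)"
  \<comment> \<open>The index \<open>i\<close> is determined by \<open>R1\<close>; it is listed so
    that the cardinality comes out as a convolution.\<close>
  define P2 where "P2 = (SIGMA A1 : Pow A. SIGMA B1 : Pow B. (A1 \<times> (B - B1)) \<times>
    (SIGMA i : {..n}. bi_graphs A1 B1 i \<times> bi_graphs (A - A1) (B - B1) (n - i)))"
  define join where "join = (\<lambda>(A1 :: 'a set, B1 :: 'b set, e :: 'a \<times> 'b, i :: nat, R1, R2 :: ('a \<times> 'b) set). (e, R1 \<union> R2))"
  define cut where "cut = (\<lambda>(e :: 'a \<times> 'b, R :: ('a \<times> 'b) set).
    let A1 = {x. (Inl (fst e), Inl x) \<in> (adj R)\<^sup>*}; B1 = {y. (Inl (fst e), Inr y) \<in> (adj R)\<^sup>*};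
      R1 = R \<inter> A1 \<times> B1
    in (A1, B1, e, card R1, R1, R \<inter> (A - A1) \<times> (B - B1)))"
  have finR: "finite R" if "R \<subseteq> A \<times> B" for R
    using that fin by (auto intro: finite_subset)
  have subR: "R \<subseteq> A \<times> B" if "R \<in> bi_graphs A B m" for R m
    using that by (auto simp: bi_graphs_def bi_connected_def)
  have finP: "finite P"
  proof (rule finite_subset)
    show "P \<subseteq> (A \<times> B) \<times> Pow (A \<times> B)"
      unfolding P_def using subR by blast
  qed (use fin in simp)
  have cardQ: "card Q = Suc n * card (bi_graphs A B (Suc n))"
  proof -
    have "card Q = (\<Sum>E\<in>bi_graphs A B (Suc n). card E)"
      unfolding Q_def using finite_bi_graphs[OF fin] finR[OF subR] by (intro card_SigmaI) auto
    also have "\<dots> = (\<Sum>E\<in>bi_graphs A B (Suc n). Suc n)"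
      by (intro sum.cong) (auto simp: bi_graphs_def)
    finally show ?thesis by simp
  qed
  have "bij_betw (\<lambda>(E, e). (e, E - {e})) Q P"
  proof (rule bij_betw_byWitness[where f' = "\<lambda>(e, R). (insert e R, e)"])
    show "(\<lambda>(E, e). (e, E - {e})) ` Q \<subseteq> P" "(\<lambda>(e, R). (insert e R, e)) ` P \<subseteq> Q"
      "\<forall>q\<in>Q. (\<lambda>(e, R). (insert e R, e)) ((\<lambda>(E, e). (e, E - {e})) q) = q"
      "\<forall>p\<in>P. (\<lambda>(E, e). (e, E - {e})) ((\<lambda>(e, R). (insert e R, e)) p) = p"
      unfolding P_def Q_def by (clarsimp simp: insert_absorb)+
  qed
  then have cardP: "card P = Suc n * card (bi_graphs A B (Suc n))"
    unfolding cardQ[symmetric] by (rule bij_betw_same_card[symmetric])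
  have cardP1: "card P1 + n * card (bi_graphs A B n) = card A * card B * card (bi_graphs A B n)"
  proof -
    have 1: "card (A \<times> B - R) + n = card A * card B" if "R \<in> bi_graphs A B n" for R
    proof -
      have "card R = n" using that by (simp add: bi_graphs_def)
      then show ?thesis
        using subR[OF that] fin finR[OF subR[OF that]] card_mono[of "A \<times> B" R]
        by (simp add: card_Diff_subset card_cartesian_product)
    qed
    have "card P1 = (\<Sum>R\<in>bi_graphs A B n. card (A \<times> B - R))"
      unfolding P1_def using finite_bi_graphs[OF fin] fin by (intro card_SigmaI) auto
    then have "card P1 + n * card (bi_graphs A B n) = (\<Sum>R\<in>bi_graphs A B n. card (A \<times> B - R) + n)"
      by (simp add: sum.distrib)
    also have "\<dots> = (\<Sum>R\<in>bi_graphs A B n. card A * card B)"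
      using 1 by (intro sum.cong) auto
    finally show ?thesis by simp
  qed
  have bij1: "bij_betw (\<lambda>(R, e). (e, R)) P1 {(e, R) \<in> P. bi_connected A B R}"
  proof (rule bij_betw_byWitness[where f' = "\<lambda>(e, R). (R, e)"])
    show "(\<lambda>(R, e). (e, R)) ` P1 \<subseteq> {(e, R) \<in> P. bi_connected A B R}"
    proof clarsimp
      fix R a b assume "(R, (a, b)) \<in> P1"
      then have R: "bi_connected A B R" "card R = n" and ab: "(a, b) \<in> A \<times> B" "(a, b) \<notin> R"
        by (auto simp: P1_def bi_graphs_def)
      have "R \<subseteq> A \<times> B" using R by (simp add: bi_connected_def)
      then have "bi_connected A B (insert (a, b) R)" "finite R"
        using ab by (auto intro: bi_connected_mono[OF R(1)] finR)
      then show "((a, b), R) \<in> P \<and> bi_connected A B R"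
        using R ab by (simp add: P_def bi_graphs_def)
    qed
    show "(\<lambda>(e, R). (R, e)) ` {(e, R) \<in> P. bi_connected A B R} \<subseteq> P1"
    proof clarsimp
      fix R a b assume "((a, b), R) \<in> P" and conn: "bi_connected A B R"
      then have ab: "(a, b) \<notin> R" and ins: "insert (a, b) R \<subseteq> A \<times> B" "card (insert (a, b) R) = Suc n"
        by (auto simp: P_def bi_graphs_def bi_connected_def)
      from ins finR[of R] ab have "card R = n" by simp
      then show "(R, (a, b)) \<in> P1"
        using ab ins conn by (simp add: P1_def bi_graphs_def)
    qed
  qed auto
  have cardP2: "card P2 = (\<Sum>A1\<in>Pow A. \<Sum>B1\<in>Pow B. card A1 * card (B - B1) *
      (\<Sum>i\<le>n. card (bi_graphs A1 B1 i) * card (bi_graphs (A - A1) (B - B1) (n - i))))"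
  proof -
    have finG: "finite (bi_graphs A1 B1 i)" if "A1 \<subseteq> A" "B1 \<subseteq> B" for A1 B1 i
      using that fin by (meson finite_bi_graphs finite_subset)
    define X where "X A1 B1 = (A1 \<times> (B - B1)) \<times>
        (SIGMA i : {..n}. bi_graphs A1 B1 i \<times> bi_graphs (A - A1) (B - B1) (n - i))" for A1 B1
    have finX: "finite (X A1 B1)" if "A1 \<subseteq> A" "B1 \<subseteq> B" for A1 B1
      unfolding X_def using that fin
      by (intro finite_cartesian_product finite_SigmaI finG) (auto intro: finite_subset)
    have "card P2 = (\<Sum>A1\<in>Pow A. card (SIGMA B1 : Pow B. X A1 B1))"
      unfolding P2_def X_def[symmetric] using fin finX
      by (intro card_SigmaI ballI finite_SigmaI) auto
    also have "\<dots> = (\<Sum>A1\<in>Pow A. \<Sum>B1\<in>Pow B. card (X A1 B1))"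
      using fin finX by (intro sum.cong refl card_SigmaI) auto
    also have "\<dots> = (\<Sum>A1\<in>Pow A. \<Sum>B1\<in>Pow B. card A1 * card (B - B1) *
      (\<Sum>i\<le>n. card (bi_graphs A1 B1 i) * card (bi_graphs (A - A1) (B - B1) (n - i))))"
      unfolding X_def using finG by (intro sum.cong refl) (simp add: card_cartesian_product)
    finally show ?thesis .
  qed
  have bij2: "bij_betw join P2 {(e, R) \<in> P. \<not> bi_connected A B R}"
  proof (rule bij_betw_byWitness[where f' = cut])
    have good: "cut (join t) = t \<and> join t \<in> {(e, R) \<in> P. \<not> bi_connected A B R}"
      if t: "t \<in> P2" for t
    proof -
      obtain A1 B1 e i R1 R2 where "t = (A1, B1, e, i, R1, R2)"
        by (cases t rule: prod_cases6)
      moreover obtain a b where "e = (a, b)"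
        by (cases e)
      ultimately have t_eq: "t = (A1, B1, (a, b), i, R1, R2)"
        by simp
      with t have sub: "A1 \<subseteq> A" "B1 \<subseteq> B" and a: "a \<in> A1" and b: "b \<in> B - B1"
        and R1: "bi_connected A1 B1 R1" "card R1 = i"
        and R2: "bi_connected (A - A1) (B - B1) R2" "card R2 = n - i" and i: "i \<le> n"
        by (auto simp: P2_def bi_graphs_def)
      have R12: "R1 \<subseteq> A1 \<times> B1" "R2 \<subseteq> (A - A1) \<times> (B - B1)"
        using R1 R2 by (auto simp: bi_connected_def)
      \<comment> \<open>The component of \<open>a\<close> is again \<open>A1 <+> B1\<close>, which
        is why \<open>cut\<close> recovers all the data from the union.\<close>
      then have comp: "(Inl a, v) \<in> (adj (R1 \<union> R2))\<^sup>* \<longleftrightarrow> v \<in> A1 <+> B1" for v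
        using R1(1) a by (intro reachable_component) auto
      have "(R1 \<union> R2) \<inter> A1 \<times> B1 = R1" "(R1 \<union> R2) \<inter> (A - A1) \<times> (B - B1) = R2"
        using R12 by auto
      moreover have "{x. Inl x \<in> A1 <+> B1} = A1" "{y. Inr y \<in> A1 <+> B1} = B1"
        by auto
      ultimately have "cut (join t) = t"
        using R1(2) by (simp add: t_eq cut_def join_def comp Let_def)
      moreover have "\<not> bi_connected A B (R1 \<union> R2)"
      proof
        assume "bi_connected A B (R1 \<union> R2)"
        then have "(Inl a, Inr b) \<in> (adj (R1 \<union> R2))\<^sup>*"
          using a b sub unfolding bi_connected_def by blast
        then show False using b comp by auto
      qed
      moreover have "((a, b), R1 \<union> R2) \<in> P"
      proof -
        have "finite R1" "finite R2" "R1 \<inter> R2 = {}" "(a, b) \<notin> R1 \<union> R2"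
          using R12 sub a b by (auto intro!: finR)
        then have "card (insert (a, b) (R1 \<union> R2)) = Suc n"
          using R1(2) R2(2) i by (simp add: card_Un_disjoint)
        then show ?thesis
          using bi_connected_join[OF R1(1) R2(1) sub a b] \<open>(a, b) \<notin> R1 \<union> R2\<close>
          by (simp add: P_def bi_graphs_def)
      qed
      ultimately show ?thesis by (simp add: t_eq join_def)
    qed
    show "\<forall>t\<in>P2. cut (join t) = t"
      by (rule ballI) (rule conjunct1[OF good])
    show "join ` P2 \<subseteq> {(e, R) \<in> P. \<not> bi_connected A B R}"
      by (rule image_subsetI) (rule conjunct2[OF good])
    have good': "join (cut p) = p \<and> cut p \<in> P2"
      if p: "p \<in> {(e, R) \<in> P. \<not> bi_connected A B R}" for p
    proof -
      obtain a b R where p_eq: "p = ((a, b), R)"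
        by (cases p) auto
      with p have conn: "bi_connected A B (insert (a, b) R)" and nconn: "\<not> bi_connected A B R"
        and ab: "(a, b) \<notin> R" and card: "card (insert (a, b) R) = Suc n"
        by (auto simp: P_def bi_graphs_def)
      define A1 where "A1 = {x. (Inl a, Inl x) \<in> (adj R)\<^sup>*}"
      define B1 where "B1 = {y. (Inl a, Inr y) \<in> (adj R)\<^sup>*}"
      define R1 where "R1 = R \<inter> A1 \<times> B1"
      define R2 where "R2 = R \<inter> (A - A1) \<times> (B - B1)"
      note parts = bi_connected_split[OF conn nconn, folded A1_def B1_def, folded R1_def R2_def]
      have cut: "cut p = (A1, B1, (a, b), card R1, R1, R2)"
        by (simp add: p_eq cut_def A1_def B1_def R1_def R2_def Let_def)
      have "finite R" using conn by (intro finR) (simp add: bi_connected_def)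
      then have fin12: "finite R1" "finite R2" and "card R = n"
        using card ab by (simp_all add: R1_def R2_def)
      moreover have "card (R1 \<union> R2) = card R1 + card R2"
        using fin12 by (rule card_Un_disjoint) (auto simp: R1_def R2_def)
      then have "card R = card R1 + card R2"
        using parts(5) by simp
      ultimately have "card R1 \<le> n" "card R2 = n - card R1" by simp_all
      then have "cut p \<in> P2"
        using parts(1-4,6,7) by (simp add: cut P2_def bi_graphs_def)
      then show ?thesis using parts(5)[symmetric] unfolding cut by (simp add: join_def p_eq)
    qed
    show "\<forall>p\<in>{(e, R) \<in> P. \<not> bi_connected A B R}. join (cut p) = p"
      by (rule ballI) (rule conjunct1[OF good'])
    show "cut ` {(e, R) \<in> P. \<not> bi_connected A B R} \<subseteq> P2"
      by (rule image_subsetI) (rule conjunct2[OF good'])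
  qed
  have "card P = card ({(e, R) \<in> P. bi_connected A B R} \<union> {(e, R) \<in> P. \<not> bi_connected A B R})"
    by (rule arg_cong[where f = card]) blast
  also have "\<dots> = card {(e, R) \<in> P. bi_connected A B R} + card {(e, R) \<in> P. \<not> bi_connected A B R}"
    by (rule card_Un_disjoint) (blast intro: finite_subset[OF _ finP])+
  finally have "card P = card P1 + card P2"
    using bij_betw_same_card[OF bij1] bij_betw_same_card[OF bij2] by simp
  then show ?thesis using cardP cardP1 cardP2 by simp
qed

section \<open>Recursion in the sizes of the two sides\<close>

lemma sum_Pow_card:
  fixes h :: "nat \<Rightarrow> nat"
  assumes "finite A"
  shows "(\<Sum>X\<in>Pow A. h (card X)) = (\<Sum>i\<le>card A. (card A choose i) * h i)"
proof -
  have "(\<Sum>X\<in>Pow A. h (card X)) = (\<Sum>i\<le>card A. \<Sum>X\<in>{X \<in> Pow A. card X = i}. h (card X))"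
    by (rule sum.group[symmetric]) (use assms card_mono in auto)
  also have "\<dots> = (\<Sum>i\<le>card A. \<Sum>X | X \<subseteq> A \<and> card X = i. h i)"
    by (intro sum.cong) auto
  finally show ?thesis using n_subsets[OF assms] by simp
qed

text \<open>By relabelling, each summand of \<open>bi_graphs_recursion\<close> depends only on the
  sizes of \<open>A1\<close> and \<open>B1\<close>, so the sums over subsets become binomial
  sums.\<close>

lemma conn_count_recursion:
  "Suc n * conn_count r s (Suc n) + n * conn_count r s n = r * s * conn_count r s n +
    (\<Sum>i\<le>r. \<Sum>j\<le>s. (r choose i) * (s choose j) * (i * (s - j) *
      (\<Sum>k\<le>n. conn_count i j k * conn_count (r - i) (s - j) (n - k))))"
proof -
  define h where "h i j = i * (s - j) *
      (\<Sum>k\<le>n. conn_count i j k * conn_count (r - i) (s - j) (n - k))" for i j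
  have "(\<Sum>A1\<in>Pow {..<r}. \<Sum>B1\<in>Pow {..<s}. card A1 * card ({..<s} - B1) *
      (\<Sum>k\<le>n. card (bi_graphs A1 B1 k) * card (bi_graphs ({..<r} - A1) ({..<s} - B1) (n - k)))) =
    (\<Sum>A1\<in>Pow {..<r}. \<Sum>B1\<in>Pow {..<s}. h (card A1) (card B1))"
  proof (intro sum.cong refl)
    fix A1 B1 assume "A1 \<in> Pow {..<r}" "B1 \<in> Pow {..<s}"
    then have "finite A1" "finite B1" "card ({..<r} - A1) = r - card A1" "card ({..<s} - B1) = s - card B1"
      by (auto intro: finite_subset simp: card_Diff_subset finite_subset[OF _ finite_lessThan])
    then show "card A1 * card ({..<s} - B1) *
      (\<Sum>k\<le>n. card (bi_graphs A1 B1 k) * card (bi_graphs ({..<r} - A1) ({..<s} - B1) (n - k))) =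
      h (card A1) (card B1)"
      by (simp add: h_def card_bi_graphs)
  qed
  also have "\<dots> = (\<Sum>i\<le>r. \<Sum>j\<le>s. (r choose i) * (s choose j) * h i j)"
    using sum_Pow_card[of "{..<r}" "\<lambda>i. \<Sum>B1\<in>Pow {..<s}. h i (card B1)"] sum_Pow_card[of "{..<s}"]
    by (simp add: sum_distrib_left mult.assoc)
  finally show ?thesis
    using bi_graphs_recursion[of "{..<r}" "{..<s}" n] by (simp add: h_def conn_count_def)
qed

lemma bi_connected_empty:
  assumes "finite A" "finite B"
  shows "bi_connected A B {} \<longleftrightarrow> card A + card B = 1"
proof -
  have no_edges: "(adj {} :: ('a + 'b) rel) = {}" by (auto simp: adj_def)
  have singleton: "S \<noteq> {} \<and> (\<forall>u\<in>S. \<forall>v\<in>S. u = v) \<longleftrightarrow> is_singleton S" for S :: "('a + 'b) set"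
    by (auto elim!: is_singletonE intro!: is_singletonI')
  have "bi_connected A B {} \<longleftrightarrow> A <+> B \<noteq> {} \<and> (\<forall>u\<in>A <+> B. \<forall>v\<in>A <+> B. u = v)"
    unfolding bi_connected_def by (simp add: no_edges del: Plus_eq_empty_conv)
  also have "\<dots> \<longleftrightarrow> is_singleton (A <+> B)"
    by (rule singleton)
  also have "\<dots> \<longleftrightarrow> card A + card B = 1"
    using assms by (simp add: is_singleton_altdef card_Plus)
  finally show ?thesis .
qed

lemma bi_graphs_0:
  assumes "finite A" "finite B"
  shows "bi_graphs A B 0 = (if card A + card B = 1 then {{}} else {})"
proof -
  have "R = {}" if "R \<in> bi_graphs A B 0" for R
    using that assms finite_subset[of R "A \<times> B"] by (auto simp: bi_graphs_def bi_connected_def)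
  then have "bi_graphs A B 0 = {R. R = {} \<and> bi_connected A B R}"
    by (auto simp: bi_graphs_def)
  then show ?thesis using bi_connected_empty[OF assms] by auto
qed

lemma conn_count_0: "conn_count r s 0 = (if r + s = 1 then 1 else 0)"
  by (simp add: conn_count_def bi_graphs_0)

text \<open>In the recursion the two pieces share \<open>n\<close> edges but more than
  \<open>n + 2\<close> vertices, so one of them has too few edges and its count vanishes by
  induction.\<close>

lemma conn_count_eq_0: "Suc m < r + s \<Longrightarrow> conn_count r s m = 0"
proof (induction m arbitrary: r s rule: less_induct)
  case (less m)
  show ?case
  proof (cases m)
    case 0
    with less.prems show ?thesis by (simp add: conn_count_0)
  next
    case (Suc n)
    have "conn_count i j k * conn_count (r - i) (s - j) (n - k) = 0"
      if "i \<le> r" "j \<le> s" "k \<le> n" for i j k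
    proof -
      have "Suc k < i + j \<or> Suc (n - k) < (r - i) + (s - j)"
        using that less.prems Suc by linarith
      moreover have "k < m" "n - k < m" using that Suc by simp_all
      ultimately show ?thesis using less.IH by auto
    qed
    then have "(\<Sum>k\<le>n. conn_count i j k * conn_count (r - i) (s - j) (n - k)) = 0"
      if "i \<le> r" "j \<le> s" for i j
      using that by (intro sum.neutral ballI) simp
    then have "(\<Sum>i\<le>r. \<Sum>j\<le>s. (r choose i) * (s choose j) * (i * (s - j) *
        (\<Sum>k\<le>n. conn_count i j k * conn_count (r - i) (s - j) (n - k)))) = 0"
      by (intro sum.neutral ballI) (simp only: atMost_iff mult_0_right)
    moreover have "conn_count r s n = 0"
      using less.IH[of n r s] less.prems Suc by simp
    ultimately have "Suc n * conn_count r s (Suc n) = 0"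
      using conn_count_recursion[of n r s] by simp
    then show ?thesis using Suc by simp
  qed
qed

section \<open>Passage to Betti numbers\<close>

lemma conn_count_no_right: "conn_count r 0 m = (if r = 1 \<and> m = 0 then 1 else 0)"
  and conn_count_no_left: "conn_count 0 s m = (if s = 1 \<and> m = 0 then 1 else 0)"
proof -
  have "m = 0" if "R \<in> bi_graphs A B m" "A = {} \<or> B = {}" for R and A B :: "nat set"
    using that by (auto simp: bi_graphs_def bi_connected_def)
  then have "m = 0 \<or> conn_count r 0 m = 0 \<and> conn_count 0 s m = 0"
    unfolding conn_count_def lessThan_0 card_eq_0_iff by blast
  then show "conn_count r 0 m = (if r = 1 \<and> m = 0 then 1 else 0)"
    "conn_count 0 s m = (if s = 1 \<and> m = 0 then 1 else 0)"
    by (auto simp: conn_count_0)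
qed

text \<open>Two-element edges and ordered pairs correspond through the injective map
  \<open>edge\<close>. For an empty side the convention in \<open>N_bi\<close> agrees with counting
  single vertices; the truncated subtraction at \<open>r = s = k = 0\<close> does no harm, as the
  empty graph is not connected.\<close>

lemma N_bi_eq_conn_count: "N_bi r s k = conn_count r s (r + s + k - 1)"
proof (cases "r = 0 \<or> s = 0")
  case True
  then show ?thesis
    by (auto simp: N_bi_def conn_count_no_left conn_count_no_right)
next
  case False
  define edge where "edge = (\<lambda>(i :: nat, j :: nat). {Inl i, Inr j :: nat + nat})"
  have inj: "inj edge"
    by (auto simp: edge_def inj_on_def doubleton_eq_iff)
  have verts: "bi_verts r s = {..<r} <+> {..<s}"
    by (simp add: bi_verts_def Plus_def)
  have edges: "complete_bi_edges r s = edge ` ({..<r} \<times> {..<s})"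
    by (auto simp: complete_bi_edges_def edge_def)
  have adj: "{(a, b). {a, b} \<in> edge ` R} = adj R" for R
    by (auto simp: adj_def edge_def doubleton_eq_iff image_iff)
  have conn: "edge ` R \<subseteq> complete_bi_edges r s \<and> graph_connected (bi_verts r s) (edge ` R) \<longleftrightarrow>
      bi_connected {..<r} {..<s} R" for R
    unfolding graph_connected_def bi_connected_def verts adj edges
    using inj by (simp add: inj_image_subset_iff)
  have card: "card (edge ` R) = card R" for R
    using inj by (intro card_image) (rule inj_on_subset[OF _ subset_UNIV])
  have "{E. E \<subseteq> complete_bi_edges r s \<and> graph_connected (bi_verts r s) E \<and> card E = m} =
      image edge ` bi_graphs {..<r} {..<s} m" (is "?L = ?R") for m
  proof
    show "?L \<subseteq> ?R"
    proof
      fix E assume E: "E \<in> ?L"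
      then obtain R where "E = edge ` R"
        unfolding edges by (auto simp: subset_image_iff)
      with E show "E \<in> ?R"
        using conn[of R] card[of R] by (auto simp: bi_graphs_def)
    qed
    show "?R \<subseteq> ?L"
      using conn card by (auto simp: bi_graphs_def)
  qed
  moreover have "inj_on (image edge) X" for X
    using inj by (auto simp: inj_on_def inj_image_eq_iff)
  ultimately show ?thesis
    using False by (simp add: N_bi_def conn_count_def card_image)
qed

text \<open>Meant for the edge counts of two pieces: if the total is the sum of the lower bounds,
  both pieces are trees.\<close>

lemma sum_mult_minimal:
  fixes f g :: "nat \<Rightarrow> nat"
  assumes "\<And>k. k < p \<Longrightarrow> f k = 0" "\<And>k. k < q \<Longrightarrow> g k = 0"
  shows "(\<Sum>k\<le>p + q. f k * g (p + q - k)) = f p * g q"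
proof -
  have "f k * g (p + q - k) = 0" if "k \<noteq> p" "k \<le> p + q" for k
    using assms(1)[of k] assms(2)[of "p + q - k"] that by (cases "k < p") auto
  then have "(\<Sum>k\<le>p + q. f k * g (p + q - k)) = (\<Sum>k\<in>{p}. f k * g (p + q - k))"
    by (intro sum.mono_neutral_right) auto
  then show ?thesis by simp
qed

text \<open>One edge above the minimal total: exactly one piece takes the surplus edge and has Betti
  number 1.\<close>

lemma sum_mult_minimal_Suc:
  fixes f g :: "nat \<Rightarrow> nat"
  assumes "\<And>k. k < p \<Longrightarrow> f k = 0" "\<And>k. k < q \<Longrightarrow> g k = 0"
  shows "(\<Sum>k\<le>Suc (p + q). f k * g (Suc (p + q) - k)) = f p * g (Suc q) + f (Suc p) * g q"
proof -
  have "f k * g (Suc (p + q) - k) = 0" if "k \<noteq> p" "k \<noteq> Suc p" "k \<le> Suc (p + q)" for k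
    using assms(1)[of k] assms(2)[of "Suc (p + q) - k"] that by (cases "k < p") auto
  then have "(\<Sum>k\<le>Suc (p + q). f k * g (Suc (p + q) - k)) = (\<Sum>k\<in>{p, Suc p}. f k * g (Suc (p + q) - k))"
    by (intro sum.mono_neutral_right) auto
  then show ?thesis by simp
qed

text \<open>For \<open>n = r + s - 2\<close>, connected graphs with \<open>Suc n\<close> edges are
  trees and there are none with \<open>n\<close> edges, so only the splitting term of
  \<open>conn_count_recursion\<close> survives. The edge count \<open>r + s - 1\<close> is spread
  over both sides.\<close>

lemma N_bi_recursion_0:
  assumes "r + s \<ge> 1"
  shows "(r + s) * N_bi r s 0 = N_bi r s 0 + (\<Sum>i\<le>r. \<Sum>j\<le>s. (r choose i) * (s choose j) *
    (i * N_bi i j 0 * ((s - j) * N_bi (r - i) (s - j) 0)))"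
proof (cases "r + s = 1")
  case True
  then show ?thesis by (auto simp: add_is_1)
next
  case False
  define n where "n = r + s - 2"
  have n: "r + s = Suc (Suc n)" using assms False by (simp add: n_def)
  have "i * (s - j) * (\<Sum>k\<le>n. conn_count i j k * conn_count (r - i) (s - j) (n - k)) =
      i * N_bi i j 0 * ((s - j) * N_bi (r - i) (s - j) 0)" if "i \<le> r" "j \<le> s" for i j
  \<comment> \<open>If either holds, the weight \<open>i * (s - j)\<close> is 0. Otherwise each
    piece contains a vertex, so neither \<open>i + j - 1\<close> nor
    \<open>(r - i) + (s - j) - 1\<close> is truncated.\<close>
  proof (cases "i = 0 \<or> j = s")
    case False
    then have "n = (i + j - 1) + ((r - i) + (s - j) - 1)" using that n by linarith
    moreover have "conn_count i j k = 0" if "k < i + j - 1" for k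
      using that by (intro conn_count_eq_0) linarith
    moreover have "conn_count (r - i) (s - j) k = 0" if "k < (r - i) + (s - j) - 1" for k
      using that by (intro conn_count_eq_0) linarith
    ultimately have "(\<Sum>k\<le>n. conn_count i j k * conn_count (r - i) (s - j) (n - k)) =
        N_bi i j 0 * N_bi (r - i) (s - j) 0"
      using sum_mult_minimal[of "i + j - 1" "conn_count i j" "(r - i) + (s - j) - 1" "conn_count (r - i) (s - j)"]
      by (simp add: N_bi_eq_conn_count)
    then show ?thesis by simp
  qed auto
  then have "(\<Sum>i\<le>r. \<Sum>j\<le>s. (r choose i) * (s choose j) * (i * (s - j) *
      (\<Sum>k\<le>n. conn_count i j k * conn_count (r - i) (s - j) (n - k)))) =
    (\<Sum>i\<le>r. \<Sum>j\<le>s. (r choose i) * (s choose j) *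
      (i * N_bi i j 0 * ((s - j) * N_bi (r - i) (s - j) 0)))"
    by (intro sum.cong refl) (simp only: atMost_iff)
  moreover have "conn_count r s n = 0" "N_bi r s 0 = conn_count r s (Suc n)"
    using n by (simp_all add: conn_count_eq_0 N_bi_eq_conn_count)
  ultimately show ?thesis
    using conn_count_recursion[of n r s] n by simp
qed

text \<open>For \<open>n = r + s - 1\<close>, a connected graph left after a deletion is a tree,
  with \<open>r * s - n\<close> places for the deleted edge; of two pieces, one is a tree and the
  other has Betti number 1.\<close>

lemma N_bi_recursion_1:
  assumes "r + s \<ge> 1"
  shows "(r + s) * N_bi r s 1 + (r + s) * N_bi r s 0 = r * s * N_bi r s 0 + N_bi r s 0 +
    (\<Sum>i\<le>r. \<Sum>j\<le>s. (r choose i) * (s choose j) *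
      (i * N_bi i j 0 * ((s - j) * N_bi (r - i) (s - j) 1))) +
    (\<Sum>i\<le>r. \<Sum>j\<le>s. (r choose i) * (s choose j) *
      (i * N_bi i j 1 * ((s - j) * N_bi (r - i) (s - j) 0)))"
proof -
  define n where "n = r + s - 1"
  have n: "r + s = Suc n" using assms by (simp add: n_def)
  have "i * (s - j) * (\<Sum>k\<le>n. conn_count i j k * conn_count (r - i) (s - j) (n - k)) =
      i * N_bi i j 0 * ((s - j) * N_bi (r - i) (s - j) 1) +
      i * N_bi i j 1 * ((s - j) * N_bi (r - i) (s - j) 0)" if "i \<le> r" "j \<le> s" for i j
  proof (cases "i = 0 \<or> j = s")
    case False
    define p where "p = i + j - 1"
    define q where "q = (r - i) + (s - j) - 1"
    have pq: "i + j = Suc p" "(r - i) + (s - j) = Suc q"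
      using False that by (auto simp: p_def q_def)
    then have "n = Suc (p + q)" using that n by linarith
    moreover have "conn_count i j k = 0" if "k < p" for k
      using that pq by (intro conn_count_eq_0) linarith
    moreover have "conn_count (r - i) (s - j) k = 0" if "k < q" for k
      using that pq by (intro conn_count_eq_0) linarith
    ultimately have "(\<Sum>k\<le>n. conn_count i j k * conn_count (r - i) (s - j) (n - k)) =
        N_bi i j 0 * N_bi (r - i) (s - j) 1 + N_bi i j 1 * N_bi (r - i) (s - j) 0"
      using sum_mult_minimal_Suc[of p "conn_count i j" q "conn_count (r - i) (s - j)"] pq
      by (simp add: N_bi_eq_conn_count)
    then show ?thesis by (simp add: algebra_simps)
  qed auto
  then have "(\<Sum>i\<le>r. \<Sum>j\<le>s. (r choose i) * (s choose j) * (i * (s - j) *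
      (\<Sum>k\<le>n. conn_count i j k * conn_count (r - i) (s - j) (n - k)))) =
    (\<Sum>i\<le>r. \<Sum>j\<le>s. (r choose i) * (s choose j) *
      (i * N_bi i j 0 * ((s - j) * N_bi (r - i) (s - j) 1))) +
    (\<Sum>i\<le>r. \<Sum>j\<le>s. (r choose i) * (s choose j) *
      (i * N_bi i j 1 * ((s - j) * N_bi (r - i) (s - j) 0)))"
    unfolding sum.distrib[symmetric] distrib_left[symmetric]
    by (intro sum.cong refl) (simp only: atMost_iff)
  moreover have "N_bi r s 1 = conn_count r s (Suc n)" "N_bi r s 0 = conn_count r s n"
    using n by (simp_all add: N_bi_eq_conn_count)
  ultimately show ?thesis
    using conn_count_recursion[of n r s] n by simp
qed

section \<open>Bivariate power series\<close>

lemma fps_fps_eqI: "(\<And>r s. G $ r $ s = H $ r $ s) \<Longrightarrow> G = (H :: 'a::zero fps fps)"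
  by (simp add: fps_eq_iff)

lemma D_x_nth [simp]: "D_x G $ r $ s = of_nat r * G $ r $ s"
  by (simp add: D_x_def fps_XD_def fps_of_nat[symmetric] del: of_nat_Suc)

lemma D_y_nth [simp]: "D_y G $ r $ s = of_nat s * G $ r $ s"
  by (simp add: D_y_def fps_XD_def)

lemma D_x_add: "D_x (G + H) = D_x G + D_x H"
  and D_y_add: "D_y (G + H) = D_y G + D_y H"
  and D_x_diff: "D_x (G - H) = D_x G - D_x H"
  and D_y_diff: "D_y (G - H) = D_y G - D_y H"
  and D_y_D_x: "D_y (D_x G) = D_x (D_y G)"
  by (auto intro!: fps_fps_eqI simp: algebra_simps)

lemma fps_fps_mult_nth:
  "(G * H) $ r $ s = (\<Sum>i\<le>r. \<Sum>j\<le>s. G $ i $ j * H $ (r - i) $ (s - j))"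
  by (simp add: fps_mult_nth fps_sum_nth atLeast0AtMost)

lemma D_x_mult: "D_x (G * H) = D_x G * H + G * D_x H"
  by (simp add: D_x_def fps_XD_def algebra_simps)

text \<open>\<open>s = j + (s - j)\<close> distributes the weight over the two factors in each term
  of the double convolution.\<close>

lemma D_y_mult: "D_y (G * H) = D_y G * H + G * D_y H"
proof (rule fps_fps_eqI)
  fix r s
  have "of_nat s * (G $ i $ j * H $ (r - i) $ (s - j)) =
      of_nat j * G $ i $ j * H $ (r - i) $ (s - j) +
      G $ i $ j * (of_nat (s - j) * H $ (r - i) $ (s - j))" if "j \<le> s" for i j
    using that by (simp add: of_nat_diff algebra_simps)
  then show "D_y (G * H) $ r $ s = (D_y G * H + G * D_y H) $ r $ s"
    by (simp add: fps_fps_mult_nth sum_distrib_left flip: sum.distrib)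
qed

lemma D_y_power: "D_y (G ^ Suc n) = of_nat (Suc n) * G ^ n * D_y G"
  by (induction n) (auto simp: D_y_mult algebra_simps)

lemma D_y_scale: "D_y (fps_const (fps_const c) * G) = fps_const (fps_const c) * D_y G"
  by (rule fps_fps_eqI) simp

section \<open>Substitution and chain rules\<close>

lemma subst2_nth: "subst2 f G $ n = (\<Sum>i\<le>n. fps_const (f $ i) * (G ^ i) $ n)"
  by (simp add: subst2_def fps_compose_nth atLeast0AtMost)

lemma D_x_subst2:
  assumes "G $ 0 = 0"
  shows "D_x (subst2 f G) = subst2 (fps_deriv f) G * D_x G"
proof -
  have "fps_deriv (Abs_fps (\<lambda>n. fps_const (f $ n))) = Abs_fps (\<lambda>n. fps_const (fps_deriv f $ n))"
    by (rule fps_ext) (simp add: fps_of_nat[symmetric] del: of_nat_Suc)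
  then show ?thesis
    using assms by (simp add: D_x_def fps_XD_def subst2_def fps_compose_deriv algebra_simps)
qed

text \<open>\<open>G ^ i\<close> has no terms of \<open>x\<close>-degree below \<open>i\<close>, so
  one partial sum gives all coefficients up to \<open>N\<close>. To such finite combinations of
  powers the product rule for \<open>D_y\<close> applies.\<close>

lemma subst2_nth_ge:
  assumes "G $ 0 = 0" "n \<le> N"
  shows "subst2 f G $ n = (\<Sum>i\<le>N. fps_const (fps_const (f $ i)) * G ^ i) $ n"
proof -
  have "(G ^ i) $ n = 0" if "n < i" for i
    using assms that by (intro startsby_zero_power_prefix[rule_format]) auto
  then show ?thesis
    using assms(2) unfolding subst2_nth fps_sum_nth
    by (intro sum.mono_neutral_cong_left) auto
qed

lemma D_y_sum: "D_y (sum g S) = (\<Sum>i\<in>S. D_y (g i))"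
  by (rule fps_fps_eqI) (simp add: fps_sum_nth sum_distrib_left)

lemma D_y_subst2:
  assumes "G $ 0 = 0"
  shows "D_y (subst2 f G) = subst2 (fps_deriv f) G * D_y G"
proof (rule fps_ext)
  fix n
  let ?p = "\<lambda>f N. \<Sum>i\<le>N. fps_const (fps_const (f $ i)) * G ^ i"
  \<comment> \<open>\<open>D_y\<close> acts inside each coefficient of the outer variable, so a
    partial sum may be inserted. It runs to \<open>Suc n\<close> because differentiation shifts the
    index and leaves a sum to \<open>n\<close>.\<close>
  have "D_y (subst2 f G) $ n = D_y (?p f (Suc n)) $ n"
    using subst2_nth_ge[OF assms, of n "Suc n" f] by (simp add: D_y_def)
  also have "D_y (?p f (Suc n)) = (\<Sum>i\<le>Suc n. fps_const (fps_const (f $ i)) * D_y (G ^ i))"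
    by (simp only: D_y_sum D_y_scale)
  also have "\<dots> = (\<Sum>i\<le>n. fps_const (fps_const (f $ Suc i)) * D_y (G ^ Suc i))"
  proof -
    have "D_y 1 = 0"
      by (rule fps_fps_eqI) (simp add: fps_one_nth)
    then show ?thesis by (subst sum.atMost_Suc_shift) simp
  qed
  also have "\<dots> = ?p (fps_deriv f) n * D_y G"
  proof -
    have "fps_const (fps_const (fps_deriv f $ i)) = fps_const (fps_const (f $ Suc i)) * of_nat (Suc i)" for i
      by (simp add: fps_of_nat[symmetric] mult.commute del: of_nat_Suc)
    then show ?thesis
      unfolding D_y_power sum_distrib_right by (intro sum.cong) (auto simp: mult_ac)
  qed
  also have "\<dots> $ n = (subst2 (fps_deriv f) G * D_y G) $ n"
    unfolding fps_mult_nth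
    by (intro sum.cong) (simp_all add: subst2_nth_ge[OF assms, of _ n])
  finally show "D_y (subst2 f G) $ n = (subst2 (fps_deriv f) G * D_y G) $ n" .
qed

section \<open>Exponential generating functions\<close>

definition egf :: "(nat \<Rightarrow> nat \<Rightarrow> rat) \<Rightarrow> rat fps fps" where
  "egf g = Abs_fps (\<lambda>r. Abs_fps (\<lambda>s. g r s / (fact r * fact s)))"

lemma egf_nth [simp]: "egf g $ r $ s = g r s / (fact r * fact s)"
  by (simp add: egf_def)

lemma egf_add: "egf g + egf h = egf (\<lambda>r s. g r s + h r s)"
  and D_x_egf: "D_x (egf g) = egf (\<lambda>r s. of_nat r * g r s)"
  and D_y_egf: "D_y (egf g) = egf (\<lambda>r s. of_nat s * g r s)"
  by (auto intro!: fps_fps_eqI simp: add_divide_distrib)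

text \<open>This turns the binomial sums in the recursions for \<open>N_bi\<close> into products of
  series.\<close>

lemma egf_mult:
  "egf g * egf h = egf (\<lambda>r s. \<Sum>i\<le>r. \<Sum>j\<le>s.
     of_nat (r choose i) * of_nat (s choose j) * (g i j * h (r - i) (s - j)))"
  by (rule fps_fps_eqI)
    (auto simp: fps_fps_mult_nth sum_divide_distrib binomial_fact intro!: sum.cong)

section \<open>Uniqueness for first-order Euler equations\<close>

text \<open>In the lowest degree of \<open>Z\<close> the equation reads \<open>(r + s) Z\<^sub>r\<^sub>s = C\<^sub>0\<^sub>0 Z\<^sub>r\<^sub>s\<close>.\<close>

lemma euler_equation_unique:
  fixes Z :: "rat fps fps"
  assumes eq: "A * D_x Z + B * D_y Z = C * Z"
    and "A $ 0 $ 0 = 1" "B $ 0 $ 0 = 1"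
    and resonant: "\<And>r s. of_nat (r + s) = C $ 0 $ 0 \<Longrightarrow> Z $ r $ s = 0"
  shows "Z = 0"
proof -
  have "\<forall>r s. r + s = n \<longrightarrow> Z $ r $ s = 0" for n
  proof (induction n rule: less_induct)
    case (less n)
    \<comment> \<open>If \<open>H\<close> starts in total degree \<open>n\<close>, every
      non-constant term of \<open>G\<close> raises it beyond degree \<open>n\<close>, so only the
      constant term of \<open>G\<close> matters there.\<close>
    have top: "(G * H) $ r $ s = G $ 0 $ 0 * H $ r $ s"
      if H: "\<And>i j. i + j < n \<Longrightarrow> H $ i $ j = 0" and rs: "r + s = n"
      for G H :: "rat fps fps" and r s
    proof -
      have "(G * H) $ r $ s =
          (\<Sum>i\<le>r. if i = 0 then \<Sum>j\<le>s. if j = 0 then G $ 0 $ 0 * H $ r $ s else 0 else 0)"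
        unfolding fps_fps_mult_nth
      proof (intro sum.cong refl)
        fix i assume "i \<in> {..r}"
        have "G $ i $ j * H $ (r - i) $ (s - j) = 0" if "j \<le> s" "i \<noteq> 0 \<or> j \<noteq> 0" for j
          using that rs \<open>i \<in> {..r}\<close> by (subst H) auto
        then have "(\<Sum>j\<le>s. G $ i $ j * H $ (r - i) $ (s - j)) =
            (\<Sum>j\<le>s. if i = 0 \<and> j = 0 then G $ 0 $ 0 * H $ r $ s else 0)"
          by (intro sum.cong) auto
        then show "(\<Sum>j\<le>s. G $ i $ j * H $ (r - i) $ (s - j)) =
            (if i = 0 then \<Sum>j\<le>s. if j = 0 then G $ 0 $ 0 * H $ r $ s else 0 else 0)"
          by (cases "i = 0") simp_all
      qed
      also have "\<dots> = G $ 0 $ 0 * H $ r $ s"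
        by simp
      finally show ?thesis .
    qed
    show ?case
    proof (intro allI impI)
      fix r s assume rs: "r + s = n"
      have "(A * D_x Z) $ r $ s = of_nat r * Z $ r $ s" "(B * D_y Z) $ r $ s = of_nat s * Z $ r $ s"
        using less.IH rs assms(2,3) by (simp_all add: top)
      then have "(A * D_x Z + B * D_y Z) $ r $ s = of_nat (r + s) * Z $ r $ s"
        by (simp add: algebra_simps)
      moreover have "(C * Z) $ r $ s = C $ 0 $ 0 * Z $ r $ s"
        using less.IH rs by (simp add: top)
      ultimately have "(of_nat (r + s) - C $ 0 $ 0) * Z $ r $ s = 0"
        using eq by (simp add: algebra_simps)
      with resonant show "Z $ r $ s = 0" by auto
    qed
  qed
  then show ?thesis by (intro fps_fps_eqI) simp
qed

section \<open>Algebra of substitution and the series \<open>f_1\<close>\<close>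

lemma subst2_add: "subst2 (f + g) G = subst2 f G + subst2 g G"
  by (rule fps_ext)
    (simp add: subst2_nth sum.distrib algebra_simps flip: fps_const_add)

lemma subst2_scale: "subst2 (fps_const c * f) G = fps_const (fps_const c) * subst2 f G"
  by (rule fps_ext)
    (simp add: subst2_nth sum_distrib_left mult.assoc flip: fps_const_mult)

lemma subst2_mult:
  assumes "G $ 0 = 0"
  shows "subst2 (f * g) G = subst2 f G * subst2 g G"
proof -
  have const_sum: "fps_const (sum h S) = (\<Sum>i\<in>S. fps_const (h i))" for h :: "nat \<Rightarrow> rat" and S
    by (rule fps_ext) (simp add: fps_sum_nth)
  have "Abs_fps (\<lambda>n. fps_const ((f * g) $ n)) =
      Abs_fps (\<lambda>n. fps_const (f $ n)) * Abs_fps (\<lambda>n. fps_const (g $ n))"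
    by (rule fps_ext) (simp add: fps_mult_nth const_sum)
  then show ?thesis
    using assms by (simp add: subst2_def fps_compose_mult_distrib)
qed

lemma subst2_X:
  assumes "G $ 0 = 0"
  shows "subst2 fps_X G = G"
proof -
  have "Abs_fps (\<lambda>n. fps_const (fps_X $ n)) = (fps_X :: rat fps fps)"
    by (rule fps_ext) (simp add: fps_X_def)
  then show ?thesis
    using assms by (simp add: subst2_def)
qed

lemma subst2_compose_uminus: "subst2 (f oo - fps_X) G = subst2 f (- G)"
proof -
  have "(- G) ^ i = fps_const (fps_const ((-1) ^ i)) * G ^ i" for i
    by (subst power_minus) (simp flip: fps_const_power fps_const_neg)
  then show ?thesis
    by (intro fps_ext) (simp add: subst2_nth fps_compose_uminus' mult_ac flip: fps_const_mult)
qed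

text \<open>The derivative is \<open>-1/2 * (1 - 1 / (1 - w)) = w / (2 * (1 - w))\<close>; the
  denominator is cleared for the later substitution.\<close>

lemma f_1_deriv: "(1 - fps_X) * fps_deriv f_1 = fps_const (1 / 2) * fps_X"
proof -
  have "fps_deriv f_1 = fps_const (- 1 / 2) * (1 - inverse (1 - fps_X))"
  proof (rule fps_ext)
    fix n
    show "fps_deriv f_1 $ n = (fps_const (- 1 / 2) * (1 - inverse (1 - fps_X))) $ n"
      by (simp add: f_1_def fps_inverse_one_minus_fps_X fps_compose_uminus' fps_ln_nth fps_X_nth field_simps)
  qed
  moreover have "(1 - fps_X) * inverse (1 - fps_X) = (1 :: rat fps)"
    by (rule inverse_mult_eq_1') simp
  then have "fps_const c * ((1 - fps_X) * (1 - inverse (1 - fps_X))) = fps_const c * ((1 - fps_X) - 1)" for c :: rat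
    by (simp only: right_diff_distrib mult_1_right)
  ultimately have "(1 - fps_X) * fps_deriv f_1 = fps_const (- 1 / 2) * ((1 - fps_X) - 1)"
    by (metis mult.left_commute)
  then show ?thesis by (simp flip: fps_const_neg)
qed

section \<open>The generating functions\<close>

lemma F_bi_eq_egf: "F_bi k = egf (\<lambda>r s. of_nat (N_bi r s k))"
  by (simp add: F_bi_def egf_def)

text \<open>A tree has one vertex more than edges. The left side marks a vertex; the product marks
  an edge, which cuts the tree into one rooted on the left and one rooted on the right.\<close>

lemma tree_equation: "D_x (F_bi 0) + D_y (F_bi 0) = F_bi 0 + D_x (F_bi 0) * D_y (F_bi 0)"
proof -
  have "of_nat r * of_nat (N_bi r s 0) + of_nat s * of_nat (N_bi r s 0) =
      (of_nat (N_bi r s 0) + (\<Sum>i\<le>r. \<Sum>j\<le>s. of_nat (r choose i) * of_nat (s choose j) *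
        (of_nat i * of_nat (N_bi i j 0) *
          (of_nat (s - j) * of_nat (N_bi (r - i) (s - j) 0)))) :: rat)" for r s
  \<comment> \<open>The recursion presupposes a vertex; for \<open>r = s = 0\<close> everything is 0
    by the convention for \<open>N_bi\<close>.\<close>
  proof (cases "r + s = 0")
    case True
    then show ?thesis by (simp add: N_bi_def)
  next
    case False
    then have "1 \<le> r + s" by linarith
    then show ?thesis
      using arg_cong[OF N_bi_recursion_0[of r s], of "of_nat :: nat \<Rightarrow> rat"]
      by (simp add: distrib_right)
  qed
  then show ?thesis
    by (simp add: F_bi_eq_egf D_x_egf D_y_egf egf_mult egf_add)
qed

text \<open>A tree has \<open>r * s - (r + s) + 1\<close> non-edges, which accounts for the terms in
  \<open>F_bi 0\<close> alone; the mixed products come from deleting a bridge.\<close>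

lemma unicyclic_equation:
  "D_x (F_bi 1) + D_y (F_bi 1) + (D_x (F_bi 0) + D_y (F_bi 0)) =
    D_x (D_y (F_bi 0)) + F_bi 0 + D_x (F_bi 0) * D_y (F_bi 1) + D_x (F_bi 1) * D_y (F_bi 0)"
proof -
  have "of_nat r * of_nat (N_bi r s 1) + of_nat s * of_nat (N_bi r s 1) +
      (of_nat r * of_nat (N_bi r s 0) + of_nat s * of_nat (N_bi r s 0)) =
      (of_nat r * (of_nat s * of_nat (N_bi r s 0)) + of_nat (N_bi r s 0) +
      (\<Sum>i\<le>r. \<Sum>j\<le>s. of_nat (r choose i) * of_nat (s choose j) *
        (of_nat i * of_nat (N_bi i j 0) *
          (of_nat (s - j) * of_nat (N_bi (r - i) (s - j) 1)))) +
      (\<Sum>i\<le>r. \<Sum>j\<le>s. of_nat (r choose i) * of_nat (s choose j) *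
        (of_nat i * of_nat (N_bi i j 1) *
          (of_nat (s - j) * of_nat (N_bi (r - i) (s - j) 0)))) :: rat)" for r s
  proof (cases "r + s = 0")
    case True
    then show ?thesis by (simp add: N_bi_def)
  next
    case False
    then have "1 \<le> r + s" by linarith
    then show ?thesis
      using arg_cong[OF N_bi_recursion_1[of r s], of "of_nat :: nat \<Rightarrow> rat"]
      by (simp add: distrib_right mult.assoc)
  qed
  then show ?thesis
    by (simp add: F_bi_eq_egf D_x_egf D_y_egf egf_mult egf_add)
qed

section \<open>Euler equations for the generating functions\<close>

lemma mult_nth_00: "(G * H :: rat fps fps) $ 0 $ 0 = G $ 0 $ 0 * H $ 0 $ 0"
  by (simp add: fps_fps_mult_nth)

lemma D_x_T_y: "D_x T_y = D_y T_x"
  by (simp add: T_x_def T_y_def D_y_D_x)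

lemma euler_T_x: "(1 - T_y) * D_x T_x + (1 - T_x) * D_y T_x = T_x"
  and euler_T_y: "(1 - T_y) * D_x T_y + (1 - T_x) * D_y T_y = T_y"
proof -
  have "T_x + T_y = F_bi 0 + T_x * T_y"
    using tree_equation by (simp add: T_x_def T_y_def)
  then have "D_x T_x + D_x T_y = T_x + (D_x T_x * T_y + T_x * D_x T_y)"
    "D_y T_x + D_y T_y = T_y + (D_y T_x * T_y + T_x * D_y T_y)"
    by (metis D_x_add D_x_mult T_x_def, metis D_y_add D_y_mult T_y_def)
  then show "(1 - T_y) * D_x T_x + (1 - T_x) * D_y T_x = T_x"
    "(1 - T_y) * D_x T_y + (1 - T_x) * D_y T_y = T_y"
    unfolding D_x_T_y by algebra+
qed

lemma D_x_1 [simp]: "D_x 1 = 0" and D_y_1 [simp]: "D_y 1 = 0"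
  by (auto intro!: fps_fps_eqI simp: fps_one_nth)

text \<open>This is \<open>D_x\<close> applied to the classical \<open>T_y = y exp(T_x)\<close>,
  obtained here from the Euler equations. The difference \<open>Z\<close> of the two sides satisfies
  an equation as in \<open>euler_equation_unique\<close> whose factor on the right has constant term
  1. Only the coefficients of \<open>x\<close> and \<open>y\<close> are resonant, and they
  vanish.\<close>

lemma D_y_T_x: "D_y T_x = T_y * D_x T_x"
proof -
  define p q t where "p = D_x T_x" and "q = D_y T_x" and "t = D_y T_y"
  define Z where "Z = q - T_y * p"
  have e1: "(1 - T_y) * p + (1 - T_x) * q = T_x"
    using euler_T_x by (simp add: p_def q_def)
  have e2: "(1 - T_y) * q + (1 - T_x) * t = T_y"
    using euler_T_y by (simp add: q_def t_def D_x_T_y)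
  have D: "D_x T_x = p" "D_y T_x = q" "D_x T_y = q" "D_y T_y = t" "D_y p = D_x q"
    by (simp_all add: p_def q_def t_def D_x_T_y D_y_D_x)
  have Lp: "(1 - T_y) * D_x p + (1 - T_x) * D_x q = p + 2 * p * q"
    using arg_cong[OF e1, of D_x] unfolding D_x_add D_x_mult D_x_diff D D_x_1
    by (simp add: algebra_simps)
  have Lq: "(1 - T_y) * D_x q + (1 - T_x) * D_y q = q + p * t + q * q"
    using arg_cong[OF e1, of D_y] unfolding D_y_add D_y_mult D_y_diff D D_y_1
    by (simp add: algebra_simps)
  have DZ: "D_x Z = D_x q - (q * p + T_y * D_x p)" "D_y Z = D_y q - (t * p + T_y * D_x q)"
    unfolding Z_def D_x_diff D_y_diff D_x_mult D_y_mult D by simp_all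
  \<comment> \<open>The extra factor \<open>1 - T_x\<close> lets \<open>e2\<close> eliminate
    \<open>t\<close>; then \<open>e1\<close> makes the right side a multiple of
    \<open>Z\<close>.\<close>
  have eq: "(1 - T_x) * (1 - T_y) * D_x Z + (1 - T_x) * (1 - T_x) * D_y Z =
      (2 * (1 - T_x) * (1 + q) - 1) * Z"
    using e1 e2 Lp Lq unfolding DZ unfolding Z_def by (simp add: algebra_simps) algebra
  have zero: "T_x $ 0 $ 0 = 0" "T_y $ 0 $ 0 = 0" "q $ 0 $ 0 = 0" "p $ 0 $ 0 = 0"
    by (simp_all add: T_x_def T_y_def q_def p_def)
  have low: "Z $ r $ s = 0" if "r + s = 1" for r s
  proof -
    have "q $ r $ s = 0" using that by (auto simp: q_def T_x_def)
    moreover have "(T_y * p) $ r $ s = 0"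
      using that zero by (cases r) (auto simp: fps_fps_mult_nth)
    ultimately show ?thesis by (simp add: Z_def)
  qed
  have "(2 * (1 - T_x) * (1 + q) - 1) $ 0 $ 0 = 1"
    using zero by (simp add: mult_nth_00 numeral_fps_const)
  then have "Z = 0"
    using zero low of_nat_eq_1_iff[where ?'a = rat]
    by (intro euler_equation_unique[OF eq]) (simp_all add: mult_nth_00 del: of_nat_add)
  then show ?thesis by (simp add: Z_def p_def q_def)
qed

text \<open>Multiply the Euler equation of \<open>T_x\<close> by \<open>T_y\<close> and replace
  \<open>T_y * D_x T_x\<close> by \<open>D_y T_x\<close>.\<close>

lemma D_y_T_x_eq_W: "D_y T_x = W * (1 + D_y T_x)"
  using euler_T_x D_y_T_x unfolding W_def
  by (simp add: algebra_simps) algebra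

lemma euler_F_1: "(1 - T_y) * D_x (F_bi 1) + (1 - T_x) * D_y (F_bi 1) = D_y T_x - W"
  using unicyclic_equation tree_equation
  unfolding W_def D_y_D_x[symmetric] T_x_def[symmetric] T_y_def[symmetric] D_x_T_y
  by (simp add: algebra_simps)

lemma euler_W: "(1 - T_y) * D_x W + (1 - T_x) * D_y W = 2 * W"
  using euler_T_x euler_T_y unfolding W_def D_x_mult D_y_mult D_x_T_y
  by (simp add: algebra_simps) algebra

text \<open>By the chain rule and \<open>euler_W\<close> the bracket equals
  \<open>2 * W * S\<close>, while \<open>f_1_deriv\<close> gives
  \<open>(1 - W) * S = W / 2\<close>.\<close>

lemma euler_f_1_W:
  "(1 - W) * ((1 - T_y) * D_x (subst2 f_1 W) + (1 - T_x) * D_y (subst2 f_1 W)) = W * W"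
proof -
  define S where "S = subst2 (fps_deriv f_1) W"
  \<comment> \<open>Only sums and products occur in this form, so the rules for
    \<open>subst2\<close> apply directly.\<close>
  have "fps_deriv f_1 = fps_const (1 / 2) * fps_X + fps_X * fps_deriv f_1"
    using f_1_deriv by algebra
  then have "S =
      fps_const (fps_const (1 / 2)) * W + W * S"
    unfolding S_def by (metis W_nth_0 subst2_X subst2_add subst2_mult subst2_scale)
  moreover have "fps_const (fps_const (1 / 2)) * 2 = (1 :: rat fps fps)"
    by (simp add: numeral_fps_const)
  ultimately have "(1 - W) * S * 2 = W"
    by algebra
  moreover have "(1 - T_y) * D_x (subst2 f_1 W) + (1 - T_x) * D_y (subst2 f_1 W) =
      S * ((1 - T_y) * D_x W + (1 - T_x) * D_y W)"
    unfolding D_x_subst2[OF W_nth_0] D_y_subst2[OF W_nth_0] S_def by (simp add: algebra_simps)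
  moreover have "(1 - W) * (S * (2 * W)) = ((1 - W) * S * 2) * W"
    by (simp add: mult_ac)
  ultimately show ?thesis
    unfolding euler_W by simp
qed

text \<open>After multiplication by \<open>1 - W\<close> both series satisfy the same Euler
  equation, with right side \<open>W * W\<close>. Their difference \<open>H\<close> solves the
  homogeneous one, whose only resonance is the constant term, and that is 0 for both.\<close>

lemma F_1_eq: "F_bi 1 = subst2 f_1 W"
proof -
  define H where "H = F_bi 1 - subst2 f_1 W"
  have eq: "(1 - W) * (1 - T_y) * D_x H + (1 - W) * (1 - T_x) * D_y H = 0 * H"
    using euler_F_1 euler_f_1_W D_y_T_x_eq_W
    unfolding H_def D_x_diff D_y_diff by algebra
  moreover have "T_x $ 0 $ 0 = 0" "T_y $ 0 $ 0 = 0" "W $ 0 $ 0 = 0"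
    by (simp_all add: T_x_def T_y_def W_nth_0)
  moreover have "H $ 0 $ 0 = 0"
    by (simp add: H_def F_bi_def N_bi_def subst2_nth f_1_def)
  ultimately have "H = 0"
    by (intro euler_equation_unique[OF eq]) (auto simp: mult_nth_00 simp flip: of_nat_add)
  then show ?thesis by (simp add: H_def)
qed

theorem proposition1p1:
  shows "F_bi 1 = subst2 f_1 W \<and>
    F_bi 1 = fps_const (fps_const (- 1 / 2)) *
      (subst2 (fps_ln 1) (- (T_x * T_y)) + T_x * T_y)"
proof -
  have "subst2 f_1 W = fps_const (fps_const (- 1 / 2)) *
      (subst2 (fps_ln 1) (- W) + W)"
    by (simp only: f_1_def subst2_scale subst2_add subst2_compose_uminus subst2_X[OF W_nth_0])
  with F_1_eq show ?thesis by (simp add: W_def)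
qed

end
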